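(* If either $K$ is a linear subspace or $A^*(\operatorname{ri}(K^* ))\cap(\operatorname{lineal}C)^{\perp}\neq\emptyset$, then $$X(0)^{\circ}=\{c\in E : Y(c)\text{ is almost feasible}\}.$$
   Context: $E,E'$ are finite-dimensional real inner-product spaces; $C\subseteq E$ and $K\subseteq E'$ are nonempty closed convex cones (so they contain the origin), with $C\neq\{0\}$ and with $C\neq E$ or $K\neq E'$; $A:E\to E'$ is linear with adjoint $A^*:E'\to E$. For a cone $D$, $D^*=\{y:\langle x,y\rangle\ge 0\ \forall x\in D\}$ is its dual cone, $D^\circ=-D^*$ its polar cone, and $\operatorname{lineal}D=D\cap(-D)$; $\operatorname{ri}$ denotes relative interior. $X(0)=\{x\in C: -A(x)\in K\}$, and for $c\in E$, $Y(c)=\{y\in K^*: A^*(y)-c\in C^*\}$. With respect to a chosen norm $\|\cdot\|$ on $E$, $Y(c)$ is called almost feasible if for every $\epsilon>0$ there exists $c^\epsilon\in E$ with $\|c^\epsilon\|\le\epsilon$ and $Y(c+c^\epsilon)\neq\emptyset$. *)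

theory Defs
  imports "HOL-Analysis.Analysis"
begin

definition dual_cone :: "'a::real_inner set \<Rightarrow> 'a set" where
  "dual_cone D = {y. \<forall>x\<in>D. 0 \<le> x \<bullet> y}"

definition polar_cone :: "'a::real_inner set \<Rightarrow> 'a set" where
  "polar_cone D = uminus ` dual_cone D"

definition lineal :: "'a::real_vector set \<Rightarrow> 'a set" where
  "lineal D = D \<inter> uminus ` D"

definition primal_zero :: "('a::real_inner \<Rightarrow> 'b::real_inner) \<Rightarrow> 'a set \<Rightarrow> 'b set \<Rightarrow> 'a set" where
  "primal_zero A C K = {x \<in> C. - A x \<in> K}"

definition dual_feasible ::
  "('a::real_inner \<Rightarrow> 'b::real_inner) \<Rightarrow> 'a set \<Rightarrow> 'b set \<Rightarrow> 'a \<Rightarrow> 'b set" where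
  "dual_feasible A C K c = {y \<in> dual_cone K. adjoint A y - c \<in> dual_cone C}"

text \<open>An arbitrary norm, unrelated to the one induced by the inner product.
  Nonnegativity follows from homogeneity and the triangle inequality.\<close>

definition is_norm :: "('a::real_vector \<Rightarrow> real) \<Rightarrow> bool" where
  "is_norm \<nu> \<longleftrightarrow>
     (\<forall>x. \<nu> x = 0 \<longleftrightarrow> x = 0) \<and>
     (\<forall>r x. \<nu> (r *\<^sub>R x) = \<bar>r\<bar> * \<nu> x) \<and>
     (\<forall>x y. \<nu> (x + y) \<le> \<nu> x + \<nu> y)"

definition almost_feasible ::
  "('a \<Rightarrow> real) \<Rightarrow> ('a::real_inner \<Rightarrow> 'b::real_inner) \<Rightarrow> 'a set \<Rightarrow> 'b set \<Rightarrow> 'a \<Rightarrow> bool" where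
  "almost_feasible \<nu> A C K c \<longleftrightarrow>
     (\<forall>\<epsilon>>0. \<exists>d. \<nu> d \<le> \<epsilon> \<and> dual_feasible A C K (c + d) \<noteq> {})"

text \<open>Finite-dimensionality as a predicate on an inner-product space: unlike the class
  \<open>euclidean_space\<close>, whose \<open>Basis\<close> is nonempty, it admits the zero space.
  (A domain containing a cone other than \<open>{0}\<close> is nonzero, so there \<open>euclidean_space\<close> loses nothing.)\<close>

definition fin_dim :: "'b::real_vector itself \<Rightarrow> bool" where
  "fin_dim _ \<longleftrightarrow> (\<exists>B::'b set. finite B \<and> span B = UNIV)"

end

theory Submission
  imports Defs
begin

text \<open>
  Write \<open>M\<close> for the set of all \<open>c\<close> with \<open>Y(c) \<noteq> \<emptyset>\<close>, so \<open>M = A\<^sup>*(K\<^sup>*) - C\<^sup>*\<close>, a convex cone.  The theorem is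
  the calculus of polar cones in disguise.  A point \<open>x\<close> has nonpositive inner product with all of
  \<open>M\<close> exactly when \<open>x\<close> lies in \<open>C\<^sup>*\<^sup>* = C\<close> and \<open>-A x\<close> lies in \<open>K\<^sup>*\<^sup>* = K\<close>; that is, the polar of \<open>M\<close> is
  \<open>X(0)\<close>.  By the bipolar theorem the polar of \<open>X(0)\<close> is then the closure of \<open>M\<close>
  (lemma \<open>polar_primal_zero_eq_closure\<close>).  Almost feasibility of \<open>Y(c)\<close> says that \<open>M\<close> comes
  arbitrarily close to \<open>c\<close> in the chosen norm, which is membership in this closure since all norms
  on a finite-dimensional space are equivalent (lemma \<open>almost_feasible_iff_closure\<close>).

  The one analytic ingredient is the separation of a point from a closed convex cone
  (lemma \<open>convex_cone_separation\<close>).  It is needed in both spaces, and the codomain of \<open>A\<close> is only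
  known to be an inner-product space spanned by a finite set.  So the nearest point of a
  closed set is found from the compactness of closed balls, which follows from
  an expansion in an orthogonal spanning set.
\<close>

section \<open>Separation from closed convex cones in finite dimension\<close>

text \<open>A linear combination with coefficients confined to intervals is a sum of one point from each of
  finitely many segments, and sums of compact sets are compact.\<close>

lemma compact_bounded_coefficients:
  fixes B :: "'b::real_normed_vector set"
  assumes "finite B"
  shows "\<exists>S. compact S \<and> (\<forall>t. (\<forall>b\<in>B. \<bar>t b\<bar> \<le> R b) \<longrightarrow> (\<Sum>b\<in>B. t b *\<^sub>R b) \<in> S)"
  using assms
proof induction
  case empty
  show ?case by (intro exI[of _ "{0}"]) simp
next
  case (insert b B)
  then obtain S where S: "compact S"
    "\<And>t. (\<forall>b\<in>B. \<bar>t b\<bar> \<le> R b) \<Longrightarrow> (\<Sum>b\<in>B. t b *\<^sub>R b) \<in> S" by blast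
  have seg: "compact ((\<lambda>r. r *\<^sub>R b) ` {- R b..R b})"
    by (intro compact_continuous_image continuous_intros compact_Icc)
  show ?case
  proof (intro exI conjI allI impI)
    show "compact {x + y | x y. x \<in> (\<lambda>r. r *\<^sub>R b) ` {- R b..R b} \<and> y \<in> S}"
      by (rule compact_sums[OF seg S(1)])
    fix t assume t: "\<forall>c\<in>insert b B. \<bar>t c\<bar> \<le> R c"
    have "t b *\<^sub>R b \<in> (\<lambda>r. r *\<^sub>R b) ` {- R b..R b}"
      using t by (intro imageI) (auto simp: abs_le_iff)
    moreover have "(\<Sum>b\<in>B. t b *\<^sub>R b) \<in> S"
      using S(2) t by blast
    ultimately show "(\<Sum>c\<in>insert b B. t c *\<^sub>R c)
        \<in> {x + y | x y. x \<in> (\<lambda>r. r *\<^sub>R b) ` {- R b..R b} \<and> y \<in> S}"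
      using insert.hyps by auto
  qed
qed

text \<open>\<open>B\<close> may contain \<open>0\<close>, as the output of Gram-Schmidt orthogonalization does; the
  quotient is then \<open>0 / 0 = 0\<close> and the term vanishes anyway.\<close>

lemma orthogonal_spanning_expansion:
  fixes x :: "'b::real_inner"
  assumes "finite B" "pairwise orthogonal B" "x \<in> span B"
  shows "x = (\<Sum>b\<in>B. (b \<bullet> x / (b \<bullet> b)) *\<^sub>R b)"
proof -
  obtain u where u: "x = (\<Sum>b\<in>B. u b *\<^sub>R b)"
    using assms(1,3) by (auto simp: span_finite)
  have "(b \<bullet> x / (b \<bullet> b)) *\<^sub>R b = u b *\<^sub>R b" if "b \<in> B" for b
  proof (cases "b = 0")
    case False
    have "b \<bullet> x = (\<Sum>c\<in>B. if c = b then u b * (b \<bullet> b) else 0)"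
      unfolding u inner_sum_right
      using assms(2) that by (intro sum.cong) (auto simp: pairwise_def orthogonal_def)
    then show ?thesis
      using False that assms(1) by simp
  qed simp
  then have "(\<Sum>b\<in>B. (b \<bullet> x / (b \<bullet> b)) *\<^sub>R b) = (\<Sum>b\<in>B. u b *\<^sub>R b)"
    by (rule sum.cong[OF refl])
  with u show ?thesis by simp
qed

text \<open>The Heine-Borel property.  In an orthogonal expansion the coefficient at \<open>b\<close> is
  at most \<open>norm x / norm b\<close> by the Cauchy-Schwarz inequality, so a ball lies in a compact
  set of combinations with bounded coefficients.\<close>

lemma fin_dim_compact_closed_Int_cball:
  fixes S :: "'b::real_inner set"
  assumes "fin_dim TYPE('b)" "closed S"
  shows "compact (S \<inter> cball 0 r)"
proof -
  obtain B :: "'b set" where B: "finite B" "span B = UNIV" "pairwise orthogonal B"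
    using assms(1) basis_orthogonal unfolding fin_dim_def by metis
  obtain T where T: "compact T"
    "\<And>t. (\<forall>b\<in>B. \<bar>t b\<bar> \<le> r / norm b) \<Longrightarrow> (\<Sum>b\<in>B. t b *\<^sub>R b) \<in> T"
    using compact_bounded_coefficients[OF B(1), of "\<lambda>b. r / norm b"] by blast
  have "x \<in> T" if "norm x \<le> r" for x
  proof -
    have "\<bar>b \<bullet> x / (b \<bullet> b)\<bar> \<le> r / norm b" for b
    proof (cases "b = 0")
      case False
      have "\<bar>b \<bullet> x\<bar> \<le> norm b * r"
        using Cauchy_Schwarz_ineq2[of b x] that by (meson mult_left_mono norm_ge_zero order_trans)
      then show ?thesis
        using False by (simp add: dot_square_norm power2_eq_square field_simps)
    qed simp
    then show ?thesis
      using T(2)[of "\<lambda>b. b \<bullet> x / (b \<bullet> b)"] orthogonal_spanning_expansion[OF B(1,3), of x] B(2)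
      by simp
  qed
  then have "cball 0 r \<subseteq> T" by auto
  then have "S \<inter> cball 0 r = (S \<inter> cball 0 r) \<inter> T" by auto
  also have "compact \<dots>"
    using T(1) assms(2) by (intro closed_Int_compact closed_Int) auto
  finally show ?thesis .
qed

lemma fin_dim_euclidean: "fin_dim TYPE('a::euclidean_space)"
  unfolding fin_dim_def by (intro exI[of _ Basis]) (simp add: span_Basis)

text \<open>Points of \<open>S\<close> that are no farther from \<open>z\<close> than some fixed \<open>a \<in> S\<close> lie in one ball, so the
  distance need only be minimized over a compact part of \<open>S\<close>.\<close>

lemma fin_dim_closest_point:
  fixes S :: "'b::real_inner set"
  assumes "fin_dim TYPE('b)" "closed S" "S \<noteq> {}"
  obtains p where "p \<in> S" "\<And>x. x \<in> S \<Longrightarrow> dist z p \<le> dist z x"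
proof -
  obtain a where a: "a \<in> S" using assms(3) by blast
  define r where "r = norm z + dist z a"
  have far: "norm x \<le> r" if "dist z x \<le> dist z a" for x
    using that norm_triangle_ineq2[of x z] unfolding r_def dist_norm norm_minus_commute[of z x]
    by linarith
  have "S \<inter> cball 0 r \<noteq> {}"
    using a far[of a] by auto
  moreover have "continuous_on (S \<inter> cball 0 r) (dist z)"
    by (intro continuous_intros)
  ultimately obtain p where p: "p \<in> S \<inter> cball 0 r" "\<forall>x\<in>S \<inter> cball 0 r. dist z p \<le> dist z x"
    using continuous_attains_inf[OF fin_dim_compact_closed_Int_cball[OF assms(1,2)]] by blast
  have "dist z p \<le> dist z a"
    using p(2) a far[of a] by auto
  then have "dist z p \<le> dist z x" if "x \<in> S" for x
    using p(2) that far[of x] by (cases "dist z x \<le> dist z a") auto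
  with p(1) show ?thesis using that by blast
qed

text \<open>If \<open>p\<close> is the point of \<open>D\<close> nearest to \<open>z\<close>, then \<open>p - z\<close> separates: it makes an angle of at most
  90 degrees with every \<open>x - p\<close> for \<open>x \<in> D\<close>.  Since \<open>D\<close> is a cone, \<open>p + x\<close> may replace \<open>x\<close> here,
  which puts \<open>p - z\<close> into the dual cone, and so may the origin, which gives the strict inequality at \<open>z\<close>.\<close>

lemma convex_cone_separation:
  fixes D :: "'b::real_inner set"
  assumes "fin_dim TYPE('b)" "convex_cone D" "closed D" "z \<notin> D"
  obtains y where "y \<in> dual_cone D" "z \<bullet> y < 0"
proof -
  obtain p where p: "p \<in> D" "\<And>x. x \<in> D \<Longrightarrow> dist z p \<le> dist z x"
    using fin_dim_closest_point[OF assms(1,3) convex_cone_nonempty[OF assms(2)]] by blast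
  have obtuse: "(z - p) \<bullet> (x - p) \<le> 0" if "x \<in> D" for x
    using any_closest_point_dot[of D p x z] assms(2,3) p that by (auto simp: convex_cone_def)
  have "0 \<le> x \<bullet> (p - z)" if "x \<in> D" for x
    using obtuse[OF convex_cone_add[OF assms(2) p(1) that]]
    by (simp add: inner_diff_left inner_diff_right inner_commute)
  moreover have "z \<bullet> (p - z) < 0"
  proof -
    have "p \<bullet> (p - z) \<le> 0"
      using obtuse[OF convex_cone_contains_0[OF assms(2)]]
      by (simp add: inner_diff_left inner_diff_right inner_commute)
    moreover have "0 < (p - z) \<bullet> (p - z)"
      using p(1) assms(4) by auto
    ultimately show ?thesis
      by (simp add: inner_diff_left inner_diff_right inner_commute)
  qed
  ultimately show ?thesis
    using that by (auto simp: dual_cone_def)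
qed

lemma bipolar_cone:
  fixes D :: "'b::real_inner set"
  assumes "fin_dim TYPE('b)" "convex_cone D" "closed D"
  shows "dual_cone (dual_cone D) = D"
proof
  show "D \<subseteq> dual_cone (dual_cone D)"
    by (auto simp: dual_cone_def inner_commute)
  show "dual_cone (dual_cone D) \<subseteq> D"
  proof
    fix z assume z: "z \<in> dual_cone (dual_cone D)"
    show "z \<in> D"
    proof (rule ccontr)
      assume "z \<notin> D"
      then obtain y where "y \<in> dual_cone D" "z \<bullet> y < 0"
        using convex_cone_separation[OF assms] by blast
      with z show False
        by (auto simp: dual_cone_def inner_commute not_less[symmetric])
    qed
  qed
qed

lemma convex_cone_dual_cone: "convex_cone (dual_cone D)"
  by (auto simp: convex_cone_iff dual_cone_def inner_add_right)

lemma convex_cone_closure: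
  fixes D :: "'a::euclidean_space set"
  assumes "convex_cone D"
  shows "convex_cone (closure D)"
  using assms by (simp add: convex_cone_def convex_closure conic_closure)

section \<open>Equivalence of norms\<close>

lemma is_norm_zero:
  assumes "is_norm \<nu>"
  shows "\<nu> 0 = 0"
  using assms unfolding is_norm_def by blast

lemma is_norm_nonneg:
  assumes "is_norm \<nu>"
  shows "0 \<le> \<nu> x"
proof -
  have "\<nu> (x + (-1) *\<^sub>R x) \<le> \<nu> x + \<nu> ((-1) *\<^sub>R x)"
    using assms unfolding is_norm_def by blast
  moreover have "\<nu> ((-1) *\<^sub>R x) = \<bar>-1\<bar> * \<nu> x"
    using assms unfolding is_norm_def by blast
  ultimately show ?thesis
    using is_norm_zero[OF assms] by simp
qed

lemma is_norm_le_norm: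
  fixes \<nu> :: "'a::euclidean_space \<Rightarrow> real"
  assumes "is_norm \<nu>"
  obtains k where "0 < k" "\<And>x. \<nu> x \<le> k * norm x"
proof -
  have subadditive: "\<nu> (\<Sum>i\<in>I. f i) \<le> (\<Sum>i\<in>I. \<nu> (f i))" if "finite I" for I and f :: "'a \<Rightarrow> 'a"
    using that
  proof induction
    case empty
    then show ?case by (simp add: is_norm_zero[OF assms])
  next
    case (insert i I)
    then show ?case
      using assms unfolding is_norm_def by (smt (verit) sum.insert)
  qed
  define k where "k = 1 + (\<Sum>i\<in>Basis. \<nu> (i::'a))"
  have "\<nu> x \<le> k * norm x" for x
  proof -
    have "\<nu> x = \<nu> (\<Sum>i\<in>Basis. (x \<bullet> i) *\<^sub>R i)"
      by (simp add: euclidean_representation)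
    also have "\<dots> \<le> (\<Sum>i\<in>Basis. \<nu> ((x \<bullet> i) *\<^sub>R i))"
      by (intro subadditive) simp
    also have "\<dots> = (\<Sum>i\<in>Basis. \<bar>x \<bullet> i\<bar> * \<nu> i)"
      using assms by (simp add: is_norm_def)
    also have "\<dots> \<le> (\<Sum>i\<in>Basis. norm x * \<nu> i)"
      by (intro sum_mono mult_right_mono is_norm_nonneg[OF assms] Basis_le_norm)
    also have "\<dots> \<le> k * norm x"
      by (simp add: k_def sum_distrib_left[symmetric] algebra_simps)
    finally show ?thesis .
  qed
  moreover have "0 < k"
    using sum_nonneg[of Basis \<nu>] is_norm_nonneg[OF assms] by (simp add: k_def add_pos_nonneg)
  ultimately show ?thesis using that by blast
qed

text \<open>By the upper bound, \<open>\<nu>\<close> is Lipschitz continuous, so it attains a minimum on the unit sphere, and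
  definiteness makes that minimum positive.\<close>

lemma norm_le_is_norm:
  fixes \<nu> :: "'a::euclidean_space \<Rightarrow> real"
  assumes "is_norm \<nu>"
  obtains m where "0 < m" "\<And>x. norm x \<le> m * \<nu> x"
proof -
  obtain k where k: "0 < k" "\<And>x. \<nu> x \<le> k * norm x"
    using is_norm_le_norm[OF assms] by blast
  have tri: "\<nu> x - \<nu> y \<le> k * dist x y" for x y
  proof -
    have "\<nu> ((x - y) + y) \<le> \<nu> (x - y) + \<nu> y"
      using assms unfolding is_norm_def by blast
    with k(2)[of "x - y"] show ?thesis by (simp add: dist_norm)
  qed
  have "\<bar>\<nu> x - \<nu> y\<bar> \<le> k * dist x y" for x y
    using tri[of x y] tri[of y x] by (simp add: dist_commute abs_le_iff)
  then have "k-lipschitz_on (sphere 0 1) \<nu>"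
    using k(1) by (intro lipschitz_onI) (auto simp: dist_real_def)
  then have cont: "continuous_on (sphere 0 1) \<nu>"
    by (rule lipschitz_on_continuous_on)
  obtain i :: 'a where "i \<in> Basis"
    using nonempty_Basis by blast
  then have "i \<in> sphere 0 1" by simp
  then obtain e where e: "e \<in> sphere 0 1" "\<And>x. x \<in> sphere 0 1 \<Longrightarrow> \<nu> e \<le> \<nu> x"
    using continuous_attains_inf[OF compact_sphere _ cont] by blast
  have "\<nu> e \<noteq> 0"
    using assms e(1) by (auto simp: is_norm_def)
  then have pos: "0 < \<nu> e"
    using is_norm_nonneg[OF assms, of e] by simp
  have "norm x \<le> inverse (\<nu> e) * \<nu> x" for x
  proof (cases "x = 0")
    case True
    then show ?thesis by (simp add: is_norm_zero[OF assms])
  next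
    case False
    have "\<nu> e \<le> \<nu> (inverse (norm x) *\<^sub>R x)"
      using False by (intro e(2)) simp
    also have "\<dots> = inverse (norm x) * \<nu> x"
      using assms by (simp add: is_norm_def)
    finally show ?thesis
      using False pos by (simp add: field_simps)
  qed
  with pos show ?thesis using that[of "inverse (\<nu> e)"] by simp
qed

section \<open>Farkas' lemma up to closure\<close>

text \<open>The \<open>adjoint\<close> is a Hilbert choice, so its defining identity needs a witness.  Each functional
  \<open>x \<mapsto> A x \<bullet> y\<close> is represented by a vector because the domain has a finite orthonormal basis;
  the codomain may be any inner-product space.\<close>

lemma adjoint_inner_right:
  fixes A :: "'a::euclidean_space \<Rightarrow> 'b::real_inner"
  assumes "linear A"
  shows "x \<bullet> adjoint A y = A x \<bullet> y"
proof -
  have "\<exists>w. \<forall>x. A x \<bullet> y = x \<bullet> w" for y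
  proof (intro exI allI)
    fix x
    have "A x \<bullet> y = A (\<Sum>i\<in>Basis. (x \<bullet> i) *\<^sub>R i) \<bullet> y"
      by (simp add: euclidean_representation)
    also have "\<dots> = x \<bullet> (\<Sum>i\<in>Basis. (A i \<bullet> y) *\<^sub>R i)"
      by (simp add: linear_sum[OF assms] linear_cmul[OF assms] inner_sum_left inner_sum_right
          mult.commute)
    finally show "A x \<bullet> y = x \<bullet> (\<Sum>i\<in>Basis. (A i \<bullet> y) *\<^sub>R i)" .
  qed
  then have "\<exists>f. \<forall>x y. A x \<bullet> y = x \<bullet> f y"
    by metis
  then show ?thesis
    unfolding adjoint_def by (rule someI2_ex) simp
qed

lemma polar_cone_iff: "c \<in> polar_cone D \<longleftrightarrow> (\<forall>x\<in>D. x \<bullet> c \<le> 0)"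
proof
  assume "\<forall>x\<in>D. x \<bullet> c \<le> 0"
  then have "- c \<in> dual_cone D" by (simp add: dual_cone_def)
  then have "- (- c) \<in> polar_cone D" unfolding polar_cone_def by (rule imageI)
  then show "c \<in> polar_cone D" by simp
qed (auto simp: polar_cone_def dual_cone_def)

text \<open>Moving the adjoint to the other side turns \<open>A\<^sup>* y - c \<in> C\<^sup>*\<close> into inequalities that are jointly
  linear in \<open>(c, y)\<close>, so adding or scaling parameters adds or scales their dual solutions.\<close>

lemma dual_feasible_set_convex_cone:
  fixes A :: "'a::euclidean_space \<Rightarrow> 'b::real_inner"
  assumes "linear A"
  shows "convex_cone {c. dual_feasible A C K c \<noteq> {}}"
proof -
  have "{c. dual_feasible A C K c \<noteq> {}} = 
    {c. \<exists>y\<in>dual_cone K. \<forall>x\<in>C. x \<bullet> c \<le> A x \<bullet> y}"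
    by (auto simp: dual_feasible_def dual_cone_def inner_diff_right adjoint_inner_right[OF assms])
  also have "convex_cone \<dots>"
  proof (unfold convex_cone_iff, intro conjI ballI allI impI)
    show "0 \<in> {c. \<exists>y\<in>dual_cone K. \<forall>x\<in>C. x \<bullet> c \<le> A x \<bullet> y}"
      using convex_cone_contains_0[OF convex_cone_dual_cone, of K] by (auto intro!: bexI[of _ 0])
  next
    fix c d assume "c \<in> {c. \<exists>y\<in>dual_cone K. \<forall>x\<in>C. x \<bullet> c \<le> A x \<bullet> y}"
      "d \<in> {c. \<exists>y\<in>dual_cone K. \<forall>x\<in>C. x \<bullet> c \<le> A x \<bullet> y}"
    then obtain y z where "y \<in> dual_cone K" "z \<in> dual_cone K"
      "\<forall>x\<in>C. x \<bullet> c \<le> A x \<bullet> y" "\<forall>x\<in>C. x \<bullet> d \<le> A x \<bullet> z" by blast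
    then show "c + d \<in> {c. \<exists>y\<in>dual_cone K. \<forall>x\<in>C. x \<bullet> c \<le> A x \<bullet> y}"
      using convex_cone_add[OF convex_cone_dual_cone, of y K z]
      by (auto intro!: bexI[of _ "y + z"] simp: inner_add_right add_mono)
  next
    fix c and r :: real assume "c \<in> {c. \<exists>y\<in>dual_cone K. \<forall>x\<in>C. x \<bullet> c \<le> A x \<bullet> y}" "0 \<le> r"
    then obtain y where "y \<in> dual_cone K" "\<forall>x\<in>C. x \<bullet> c \<le> A x \<bullet> y" by blast
    then show "r *\<^sub>R c \<in> {c. \<exists>y\<in>dual_cone K. \<forall>x\<in>C. x \<bullet> c \<le> A x \<bullet> y}"
      using convex_cone_scaleR[OF convex_cone_dual_cone \<open>0 \<le> r\<close>, of y K] \<open>0 \<le> r\<close>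
      by (auto intro!: bexI[of _ "r *\<^sub>R y"] mult_left_mono)
  qed
  finally show ?thesis .
qed

text \<open>The two norm comparisons serve one direction each: a \<open>\<nu>\<close>-small perturbation must be
  small in the Euclidean norm, and vice versa.\<close>

lemma almost_feasible_iff_closure:
  fixes A :: "'a::euclidean_space \<Rightarrow> 'b::real_inner"
  assumes "is_norm \<nu>"
  shows "almost_feasible \<nu> A C K c \<longleftrightarrow> c \<in> closure {c. dual_feasible A C K c \<noteq> {}}"
proof
  assume af: "almost_feasible \<nu> A C K c"
  obtain m where m: "0 < m" "\<And>x. norm x \<le> m * \<nu> x"
    using norm_le_is_norm[OF assms] by blast
  show "c \<in> closure {c. dual_feasible A C K c \<noteq> {}}"
    unfolding closure_approachable_le
  proof (intro allI impI)
    fix e :: real assume "0 < e"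
    then have "0 < e / m" using m by simp
    then obtain d where d: "\<nu> d \<le> e / m" "dual_feasible A C K (c + d) \<noteq> {}"
      using af unfolding almost_feasible_def by blast
    have "norm d \<le> m * (e / m)"
      using m(2)[of d] mult_left_mono[OF d(1), of m] m(1) by linarith
    then show "\<exists>y\<in>{c. dual_feasible A C K c \<noteq> {}}. dist y c \<le> e"
      using d(2) m(1) by (intro bexI[of _ "c + d"]) (auto simp: dist_norm)
  qed
next
  assume cl: "c \<in> closure {c. dual_feasible A C K c \<noteq> {}}"
  obtain k where k: "0 < k" "\<And>x. \<nu> x \<le> k * norm x"
    using is_norm_le_norm[OF assms] by blast
  show "almost_feasible \<nu> A C K c"
    unfolding almost_feasible_def
  proof (intro allI impI)
    fix e :: real assume "0 < e"
    then have "0 < e / k" using k by simp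
    then obtain b where b: "dual_feasible A C K b \<noteq> {}" "dist b c < e / k"
      using cl unfolding closure_approachable by blast
    have "\<nu> (b - c) \<le> k * (e / k)"
      using k(2)[of "b - c"] mult_left_mono[of "norm (b - c)" "e / k" k] b(2) k(1)
      by (simp add: dist_norm)
    then show "\<exists>d. \<nu> d \<le> e \<and> dual_feasible A C K (c + d) \<noteq> {}"
      using b(1) k(1) by (intro exI[of _ "b - c"]) simp
  qed
qed

text \<open>One inclusion is weak duality together with the closedness of polar cones.  For the other, a
  functional \<open>y\<close> that separates \<open>c\<close> from the closure is nonnegative on \<open>A\<^sup>*(K\<^sup>*)\<close> and on
  \<open>-C\<^sup>*\<close>; by the bipolar theorem \<open>-y\<close> then lies in \<open>X(0)\<close>, and it witnesses that \<open>c\<close> is not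
  in the polar cone.\<close>

theorem polar_primal_zero_eq_closure:
  fixes A :: "'a::euclidean_space \<Rightarrow> 'b::real_inner"
  assumes fin: "fin_dim TYPE('b)" and lin: "linear A"
    and C: "convex_cone C" "closed C" and K: "convex_cone K" "closed K"
  shows "polar_cone (primal_zero A C K) = closure {c. dual_feasible A C K c \<noteq> {}}"
    (is "?P = closure ?M")
proof
  have "?P = (\<Inter>x\<in>primal_zero A C K. {c. x \<bullet> c \<le> 0})"
    by (auto simp: polar_cone_iff)
  then have "closed ?P"
    by (simp add: closed_halfspace_le closed_INT)
  moreover have "?M \<subseteq> ?P"
  proof
    fix c assume "c \<in> ?M"
    then obtain y where y: "y \<in> dual_cone K" "adjoint A y - c \<in> dual_cone C"
      by (auto simp: dual_feasible_def)
    have "x \<bullet> c \<le> 0" if "x \<in> C" "- A x \<in> K" for x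
    proof -
      have "0 \<le> x \<bullet> (adjoint A y - c)" "0 \<le> - A x \<bullet> y"
        using y that unfolding dual_cone_def by blast+
      then show ?thesis
        by (simp add: inner_diff_right adjoint_inner_right[OF lin])
    qed
    then show "c \<in> ?P" by (auto simp: polar_cone_iff primal_zero_def)
  qed
  ultimately show "closure ?M \<subseteq> ?P"
    by (rule closure_minimal[rotated])
  show "?P \<subseteq> closure ?M"
  proof (rule subsetI, rule ccontr)
    fix c assume c: "c \<in> ?P" "c \<notin> closure ?M"
    obtain y where y: "y \<in> dual_cone (closure ?M)" "c \<bullet> y < 0"
      using convex_cone_separation[OF fin_dim_euclidean
          convex_cone_closure[OF dual_feasible_set_convex_cone[OF lin]] closed_closure c(2)]
      by blast
    have y_M: "0 \<le> d \<bullet> y" if "d \<in> ?M" for d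
      using y(1) that closure_subset[of ?M] unfolding dual_cone_def by blast
    have "- y \<in> dual_cone (dual_cone C)"
    proof -
      have "0 \<le> w \<bullet> - y" if "w \<in> dual_cone C" for w
      proof -
        \<comment> \<open>The choice \<open>y = 0\<close> shows that \<open>-C\<^sup>*\<close> consists of parameters with a feasible dual.\<close>
        have "adjoint A 0 = 0"
          using adjoint_inner_right[OF lin, of "adjoint A 0" 0] by simp
        then have "0 \<in> dual_feasible A C K (- w)"
          using that by (simp add: dual_feasible_def dual_cone_def)
        then show ?thesis using y_M[of "- w"] by auto
      qed
      then show ?thesis by (simp add: dual_cone_def)
    qed
    moreover have "- A (- y) \<in> dual_cone (dual_cone K)"
    proof -
      have "0 \<le> k \<bullet> - A (- y)" if "k \<in> dual_cone K" for k
      proof -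
        have "k \<in> dual_feasible A C K (adjoint A k)"
          using that by (simp add: dual_feasible_def dual_cone_def)
        then have "0 \<le> adjoint A k \<bullet> y" using y_M by blast
        then show ?thesis
          using adjoint_inner_right[OF lin, of y k]
          by (simp add: inner_commute linear_neg[OF lin])
      qed
      then show ?thesis by (simp add: dual_cone_def)
    qed
    ultimately have "- y \<in> primal_zero A C K"
      using bipolar_cone[OF fin_dim_euclidean C] bipolar_cone[OF fin K]
      by (simp add: primal_zero_def)
    then have "- y \<bullet> c \<le> 0" using c(1) by (auto simp: polar_cone_iff)
    with y(2) show False by (simp add: inner_commute)
  qed
qed

theorem theorem3:
  fixes A :: "'a::euclidean_space \<Rightarrow> 'b::real_inner"
    and C :: "'a set" and K :: "'b set" and \<nu> :: "'a \<Rightarrow> real"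
  assumes "fin_dim TYPE('b)"
    and "linear A"
    and "convex_cone C" and "closed C"
    and "convex_cone K" and "closed K"
    and "C \<noteq> {0}"
    and "C \<noteq> UNIV \<or> K \<noteq> UNIV"
    and "is_norm \<nu>"
    and "subspace K \<or>
         adjoint A ` rel_interior (dual_cone K) \<inter> orthogonal_comp (lineal C) \<noteq> {}"
  shows "polar_cone (primal_zero A C K) = {c. almost_feasible \<nu> A C K c}"
  using polar_primal_zero_eq_closure[OF assms(1-6)] almost_feasible_iff_closure[OF assms(9)]
  by blast

end
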